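(* Let $n_{\mathcal G},k_{\mathcal G},n_{\mathcal H},k_{\mathcal H}$ be integers with $k_{\mathcal G}=n_{\mathcal G}\ge2$ and $k_{\mathcal H}=n_{\mathcal H}-1\ge2$. Then the polynomials $$s_g=\Bigl(\sum_{h\in V(\mathcal H)}x_{gh}\Bigr)-k_{\mathcal H}\qquad\text{for } g\in V(\mathcal G)$$ are a $1$-sos certificate of $f^{*}=\bigl(\sum_{g\in V(\mathcal G),h\in V(\mathcal H)}x_{gh}\bigr)-k_{\mathcal G}k_{\mathcal H}$, i.e. $$f^{*}\equiv\sum_{g\in V(\mathcal G)}s_g^2\mod I_{\mathrm{sos}}.$$ Consequently Vizing's conjecture holds for these parameters: $\gamma(G)\gamma(H)\le\gamma(G\Box H)$ for all graphs $G$ on $n_{\mathcal G}$ vertices with domination number $k_{\mathcal G}$ and all graphs $H$ on $n_{\mathcal H}$ vertices with domination number $k_{\mathcal H}$.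
   Context: Graphs are finite and simple. A set $D\subseteq V(G)$ is dominating in $G$ if every vertex of $V(G)\setminus D$ is adjacent to some vertex of $D$; the domination number $\gamma(G)$ is the minimum size of a dominating set. The Cartesian product $G\Box H$ has vertex set $V(G)\times V(H)$, with $gh$ and $g'h'$ adjacent iff ($g=g'$ and $hh'\in E(H)$) or ($h=h'$ and $gg'\in E(G)$). Let $\mathbb K\subseteq\mathbb R$ be a field. An $\ell$-sos certificate of $f$ modulo an ideal $I$ is a finite family of polynomials $s_i$ of degree at most $\ell$ with $f\equiv\sum_i s_i^2\bmod I$. Given positive integers $k_{\mathcal G}\le n_{\mathcal G}$ and $k_{\mathcal H}\le n_{\mathcal H}$, fix a set $V(\mathcal G)$ of $n_{\mathcal G}$ vertices with a fixed subset $D_{\mathcal G}$ of size $k_{\mathcal G}$, and a set $V(\mathcal H)$ of $n_{\mathcal H}$ vertices with a fixed subset $D_{\mathcal H}$ of size $k_{\mathcal H}$. Introduce variables $e_{gg'}=e_{g'g}$ for each 2-element subset $\{g,g'\}\subseteq V(\mathcal G)$, variables $e_{hh'}=e_{h'h}$ for each 2-element subset $\{h,h'\}\subseteq V(\mathcal H)$, and variables $x_{gh}$ for $g\in V(\mathcal G)$, $h\in V(\mathcal H)$ (all distinct). Let $P$ be the polynomial ring over $\mathbb K$ in all these variables. The ideal $I_{\mathrm{sos}}\subseteq P$ is generated by the following polynomials: - $e_{gg'}^2-e_{gg'}$ for $\{g,g'\}\subseteq V(\mathcal G)$; $\prod_{g'\in D_{\mathcal G}}(1-e_{gg'})$ for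 $g\in V(\mathcal G)\setminus D_{\mathcal G}$; $\prod_{g'\in V(\mathcal G)\setminus S}\bigl(\sum_{g\in S}e_{gg'}\bigr)$ for $S\subseteq V(\mathcal G)$ with $|S|=k_{\mathcal G}-1$; - the same three families with $\mathcal H$ in place of $\mathcal G$ (variables $e_{hh'}$, set $D_{\mathcal H}$, size $k_{\mathcal H}$); - $x_{gh}^2-x_{gh}$ and $(1-x_{gh})\prod_{g'\in V(\mathcal G),\,g'\ne g}(1-e_{gg'}x_{g'h})\prod_{h'\in V(\mathcal H),\,h'\neq h}(1-e_{hh'}x_{gh'})$ for $g\in V(\mathcal G)$, $h\in V(\mathcal H)$. *)

theory Defs
  imports
    "HOL-Library.Poly_Mapping"
    "HOL-Algebra.Algebraic_Closure_Type"
    "Graph_Theory.Pair_Digraph"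
begin

text \<open>Finite simple graphs are the \<^locale>\<open>pair_graph\<close>s: finite, loop-free, symmetric arc relations.\<close>

definition dominating :: "'a pair_pre_digraph \<Rightarrow> 'a set \<Rightarrow> bool" where
  "dominating G D \<longleftrightarrow>
     D \<subseteq> pverts G \<and> (\<forall>v \<in> pverts G - D. \<exists>u \<in> D. (v, u) \<in> parcs G)"

definition domination_number :: "'a pair_pre_digraph \<Rightarrow> nat" where
  "domination_number G = Min {card D | D. dominating G D}"

definition cartesian_graph_product ::
  "'a pair_pre_digraph \<Rightarrow> 'b pair_pre_digraph \<Rightarrow> ('a \<times> 'b) pair_pre_digraph" where
  "cartesian_graph_product G H =
     \<lparr> pverts = pverts G \<times> pverts H,
       parcs = {((g, h), (g', h')) | g h g' h'.
                  (g = g' \<and> g \<in> pverts G \<and> (h, h') \<in> parcs H) \<or>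
                  (h = h' \<and> h \<in> pverts H \<and> (g, g') \<in> parcs G)} \<rparr>"


text \<open>
  Polynomials with real coefficients in variables of type \<open>'v\<close>: finitely supported maps from
  monomials (themselves finitely supported exponent vectors) to coefficients.
\<close>

type_synonym 'v mpoly = "('v \<Rightarrow>\<^sub>0 nat) \<Rightarrow>\<^sub>0 real"

definition Var :: "'v \<Rightarrow> 'v mpoly" where
  "Var v = Poly_Mapping.single (Poly_Mapping.single v 1) 1"

text \<open>The ring \<open>K[A]\<close> of polynomials with coefficients in \<open>K\<close> and variables in \<open>A\<close>.\<close>

definition poly_ring :: "real set \<Rightarrow> 'v set \<Rightarrow> 'v mpoly ring" where
  "poly_ring K A = ring_of_type_algebra
     \<lparr> carrier := {p. (\<forall>m. Poly_Mapping.lookup p m \<in> K) \<and>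
                      (\<forall>m \<in> Poly_Mapping.keys p. Poly_Mapping.keys m \<subseteq> A)} \<rparr>"

definition monomial_degree :: "('v \<Rightarrow>\<^sub>0 nat) \<Rightarrow> nat" where
  "monomial_degree m = (\<Sum>v \<in> Poly_Mapping.keys m. Poly_Mapping.lookup m v)"

text \<open>The zero polynomial gets degree 0.\<close>

definition total_degree :: "'v mpoly \<Rightarrow> nat" where
  "total_degree p = Max (insert 0 (monomial_degree ` Poly_Mapping.keys p))"

text \<open>The family \<open>s\<close>, indexed by \<open>J\<close>, is an \<open>l\<close>-sos certificate of \<open>f\<close> modulo the ideal \<open>I\<close>
  of the polynomial ring \<open>P\<close>.\<close>

definition sos_certificate ::
  "'v mpoly ring \<Rightarrow> 'v mpoly set \<Rightarrow> nat \<Rightarrow> 'v mpoly \<Rightarrow> 'j set \<Rightarrow> ('j \<Rightarrow> 'v mpoly) \<Rightarrow> bool" where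
  "sos_certificate P I l f J s \<longleftrightarrow>
     finite J \<and> f \<in> carrier P \<and>
     (\<forall>j \<in> J. s j \<in> carrier P \<and> total_degree (s j) \<le> l) \<and>
     f - (\<Sum>j \<in> J. (s j)\<^sup>2) \<in> I"


text \<open>
  Edge variables are indexed by 2-element sets, which makes \<open>e\<^bsub>gg'\<^esub> = e\<^bsub>g'g\<^esub>\<close> an identity.
  The type has further elements (e.g. \<open>EdgeG {g}\<close>); the variables
  of the polynomial ring are only those in \<open>vizing_vars\<close>.
\<close>

datatype ('a, 'b) vizing_var = EdgeG "'a set" | EdgeH "'b set" | Vert 'a 'b

definition vizing_vars :: "'a set \<Rightarrow> 'b set \<Rightarrow> ('a, 'b) vizing_var set" where
  "vizing_vars VG VH =
     {EdgeG {g, g'} | g g'. g \<in> VG \<and> g' \<in> VG \<and> g \<noteq> g'} \<union>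
     {EdgeH {h, h'} | h h'. h \<in> VH \<and> h' \<in> VH \<and> h \<noteq> h'} \<union>
     {Vert g h | g h. g \<in> VG \<and> h \<in> VH}"

definition vizing_ring :: "real set \<Rightarrow> 'a set \<Rightarrow> 'b set \<Rightarrow> ('a, 'b) vizing_var mpoly ring" where
  "vizing_ring K VG VH = poly_ring K (vizing_vars VG VH)"

definition eG :: "'a \<Rightarrow> 'a \<Rightarrow> ('a, 'b) vizing_var mpoly" where
  "eG g g' = Var (EdgeG {g, g'})"

definition eH :: "'b \<Rightarrow> 'b \<Rightarrow> ('a, 'b) vizing_var mpoly" where
  "eH h h' = Var (EdgeH {h, h'})"

definition xGH :: "'a \<Rightarrow> 'b \<Rightarrow> ('a, 'b) vizing_var mpoly" where
  "xGH g h = Var (Vert g h)"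

text \<open>The generators for one factor: \<open>V\<close> is its vertex set, \<open>D\<close> the fixed
  dominating set, \<open>k\<close> the domination number and \<open>e\<close> the edge variables.\<close>

definition factor_gens ::
  "('c \<Rightarrow> 'c \<Rightarrow> 'v mpoly) \<Rightarrow> 'c set \<Rightarrow> 'c set \<Rightarrow> nat \<Rightarrow> 'v mpoly set" where
  "factor_gens e V D k =
     {(e v v')\<^sup>2 - e v v' | v v'. v \<in> V \<and> v' \<in> V \<and> v \<noteq> v'} \<union>
     {(\<Prod>v' \<in> D. 1 - e v v') | v. v \<in> V - D} \<union>
     {(\<Prod>v' \<in> V - S. \<Sum>v \<in> S. e v v') | S. S \<subseteq> V \<and> card S = k - 1}"

definition product_gens :: "'a set \<Rightarrow> 'b set \<Rightarrow> ('a, 'b) vizing_var mpoly set" where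
  "product_gens VG VH =
     {(xGH g h)\<^sup>2 - xGH g h | g h. g \<in> VG \<and> h \<in> VH} \<union>
     {(1 - xGH g h) * (\<Prod>g' \<in> VG - {g}. 1 - eG g g' * xGH g' h)
                    * (\<Prod>h' \<in> VH - {h}. 1 - eH h h' * xGH g h')
       | g h. g \<in> VG \<and> h \<in> VH}"

definition I_sos ::
  "real set \<Rightarrow> 'a set \<Rightarrow> 'a set \<Rightarrow> nat \<Rightarrow> 'b set \<Rightarrow> 'b set \<Rightarrow> nat \<Rightarrow> ('a, 'b) vizing_var mpoly set" where
  "I_sos K VG DG kG VH DH kH =
     Idl\<^bsub>vizing_ring K VG VH\<^esub>
       (factor_gens eG VG DG kG \<union> factor_gens eH VH DH kH \<union> product_gens VG VH)"

end

theory Submission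
  imports Defs
begin

text \<open>
  A sum of idempotents that vanishes modulo \<open>I\<close> has vanishing summands, since positive
  integers are invertible. As \<open>k\<^sub>G = n\<^sub>G\<close>, this kills all edge variables
  of \<open>G\<close>. As \<open>k\<^sub>H = n\<^sub>H - 1\<close>, it kills all products of two distinct edge variables of \<open>H\<close>, so that
  for the vertex \<open>d\<close> outside \<open>D\<^sub>H\<close> the variables \<open>e\<^bsub>dc\<^esub>\<close> are orthogonal
  idempotents with sum 1. Multiplying by \<open>e\<^bsub>dc\<^esub>\<close> reduces \<open>H\<close> to the single edge \<open>dc\<close>; then
  \<open>x\<^bsub>gh\<^esub> = 1\<close> for \<open>h \<notin> {d, c}\<close> and \<open>(1 - x\<^bsub>gd\<^esub>) (1 - x\<^bsub>gc\<^esub>) = 0\<close>, whence \<open>s\<^sub>g\<close> is idempotent.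
  Therefore the sum of the \<open>s\<^sub>g\<^sup>2\<close> is the sum of the \<open>s\<^sub>g\<close>, which is \<open>f\<^sup>*\<close>.
  For the graphs themselves, \<open>G\<close> has no edges, so every \<open>H\<close>-fibre of a dominating set of the
  Cartesian product dominates \<open>H\<close>.
\<close>

section \<open>Congruences modulo an ideal when positive integers are invertible\<close>

text \<open>\<open>C\<close> is a subring of the ambient type and \<open>I\<close> an ideal of
  \<open>C\<close>, both plain sets, so that congruences can be verified with the type-class
  operations and \<open>algebra_simps\<close>.\<close>

locale rational_ideal =
  fixes C I :: "'r::comm_ring_1 set"
  assumes one_closed: "1 \<in> C"
    and diff_closed: "a \<in> C \<Longrightarrow> b \<in> C \<Longrightarrow> a - b \<in> C"
    and mult_closed: "a \<in> C \<Longrightarrow> b \<in> C \<Longrightarrow> a * b \<in> C"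
    and nat_invertible: "0 < n \<Longrightarrow> \<exists>c\<in>C. c * of_nat n = 1"
    and ideal_subset: "I \<subseteq> C"
    and ideal_zero: "0 \<in> I"
    and ideal_add: "a \<in> I \<Longrightarrow> b \<in> I \<Longrightarrow> a + b \<in> I"
    and ideal_mult: "c \<in> C \<Longrightarrow> a \<in> I \<Longrightarrow> c * a \<in> I"
begin

lemma zero_closed: "0 \<in> C"
  using diff_closed[OF one_closed one_closed] by simp

lemma add_closed: "a \<in> C \<Longrightarrow> b \<in> C \<Longrightarrow> a + b \<in> C"
  using diff_closed[of a "0 - b"] diff_closed[of 0 b] zero_closed by simp

lemma sum_closed: "(\<And>i. i \<in> F \<Longrightarrow> f i \<in> C) \<Longrightarrow> sum f F \<in> C"
  by (induction F rule: infinite_finite_induct) (auto intro: zero_closed add_closed)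

lemma prod_closed: "(\<And>i. i \<in> F \<Longrightarrow> f i \<in> C) \<Longrightarrow> prod f F \<in> C"
  by (induction F rule: infinite_finite_induct) (auto intro: one_closed mult_closed)

lemma of_nat_closed: "of_nat n \<in> C"
  by (induction n) (auto intro: zero_closed one_closed add_closed)

lemma numeral_closed: "numeral n \<in> C"
  using of_nat_closed[of "numeral n"] by simp

lemmas closed = one_closed diff_closed mult_closed zero_closed add_closed sum_closed
  prod_closed of_nat_closed numeral_closed

lemma ideal_uminus: "a \<in> I \<Longrightarrow> - a \<in> I"
  using ideal_mult[OF diff_closed[OF zero_closed one_closed], of a] by simp

lemma ideal_diff: "a \<in> I \<Longrightarrow> b \<in> I \<Longrightarrow> a - b \<in> I"
  using ideal_add[of a "- b"] ideal_uminus by simp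

lemma ideal_sum: "(\<And>i. i \<in> F \<Longrightarrow> f i \<in> I) \<Longrightarrow> sum f F \<in> I"
  by (induction F rule: infinite_finite_induct) (auto intro: ideal_zero ideal_add)

text \<open>Since \<open>u\<close> kills every \<open>a i\<close>, each factor
  \<open>1 - a i\<close> acts on \<open>u\<close> as the identity modulo \<open>I\<close>. This is
  how the products in the generators collapse later.\<close>

lemma mult_prod_one_minus:
  assumes "finite F" and "u \<in> C"
    and "\<And>i. i \<in> F \<Longrightarrow> a i \<in> C" and "\<And>i. i \<in> F \<Longrightarrow> u * a i \<in> I"
  shows "u * (\<Prod>i\<in>F. 1 - a i) - u \<in> I"
  using assms(1,3,4)
proof (induction F rule: finite_induct)
  case empty
  show ?case by (simp add: ideal_zero)
next
  case (insert j F)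
  let ?P = "\<Prod>i\<in>F. 1 - a i"
  have "?P * (u * a j) \<in> I"
    using insert.prems by (intro ideal_mult[of ?P "u * a j"]) (auto intro!: prod_closed diff_closed one_closed)
  then have "(u * ?P - u) - ?P * (u * a j) \<in> I"
    using insert.IH insert.prems by (intro ideal_diff[of "u * ?P - u"]) auto
  then show ?case
    using insert.hyps by (simp add: algebra_simps)
qed

text \<open>On expanding the product, all terms with at least two of the \<open>a i\<close> vanish.
  In the induction, \<open>a j\<close> times the old product is congruent to \<open>a j\<close> by
  the preceding lemma.\<close>

lemma prod_one_minus_orthogonal:
  assumes "finite F" and "\<And>i. i \<in> F \<Longrightarrow> a i \<in> C"
    and "\<And>i j. i \<in> F \<Longrightarrow> j \<in> F \<Longrightarrow> i \<noteq> j \<Longrightarrow> a i * a j \<in> I"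
  shows "(\<Prod>i\<in>F. 1 - a i) - (1 - (\<Sum>i\<in>F. a i)) \<in> I"
  using assms
proof (induction F rule: finite_induct)
  case empty
  show ?case by (simp add: ideal_zero)
next
  case (insert j F)
  let ?P = "\<Prod>i\<in>F. 1 - a i"
  have "a j * ?P - a j \<in> I"
    using insert by (intro mult_prod_one_minus) auto
  then have "(?P - (1 - (\<Sum>i\<in>F. a i))) - (a j * ?P - a j) \<in> I"
    using insert.IH insert.prems by (intro ideal_diff[of "?P - (1 - (\<Sum>i\<in>F. a i))"]) auto
  then show ?case
    using insert.hyps by (simp add: algebra_simps)
qed

text \<open>Induction on \<open>F\<close>: multiplying by \<open>e\<^sub>j\<close> turns \<open>n\<close> into \<open>n + 1\<close>, which shows \<open>u e\<^sub>j \<in> I\<close>.\<close>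

lemma annihilator_positive_plus_idempotents:
  assumes "finite F" and "\<And>i. i \<in> F \<Longrightarrow> e i \<in> C"
    and "\<And>i. i \<in> F \<Longrightarrow> (e i)\<^sup>2 - e i \<in> I"
    and "u \<in> C" and "0 < n" and "u * (of_nat n + (\<Sum>i\<in>F. e i)) \<in> I"
  shows "u \<in> I"
  using assms
proof (induction F arbitrary: u n rule: finite_induct)
  case empty
  obtain c where "c \<in> C" "c * of_nat n = 1"
    using nat_invertible empty.prems by blast
  moreover have "c * (u * of_nat n) \<in> I"
    using empty.prems ideal_mult[OF \<open>c \<in> C\<close>] by simp
  ultimately show ?case
    by (metis mult.left_commute mult.right_neutral)
next
  case (insert j F)
  let ?s = "\<Sum>i\<in>F. e i"
  have C: "e j \<in> C" "?s \<in> C" "u \<in> C"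
    using insert.prems by (auto intro: closed)
  have idem: "(e j)\<^sup>2 - e j \<in> I"
    using insert.prems by auto
  have main: "u * (of_nat n + (e j + ?s)) \<in> I"
    using insert by simp
  have "u * e j * (of_nat (Suc n) + ?s) = e j * (u * (of_nat n + (e j + ?s))) - u * ((e j)\<^sup>2 - e j)"
    by (simp add: algebra_simps power2_eq_square)
  also have "\<dots> \<in> I"
    using C idem main by (intro ideal_diff[OF ideal_mult ideal_mult])
  finally have ue: "u * e j \<in> I"
    using insert.prems C by (intro insert.IH[of "u * e j" "Suc n"]) (auto intro: closed)
  have "u * (of_nat n + ?s) = u * (of_nat n + (e j + ?s)) - u * e j"
    by (simp add: algebra_simps)
  also have "\<dots> \<in> I"
    using main ue by (rule ideal_diff)
  finally show "u \<in> I"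
    using insert.prems by (intro insert.IH[of u n]) auto
qed

text \<open>Multiplied by \<open>e j\<close>, the sum becomes \<open>e j\<close> times one plus the
  other idempotents; the preceding lemma with \<open>n = 1\<close> cancels that factor.\<close>

lemma summand_in_ideal:
  assumes "finite F" and "\<And>i. i \<in> F \<Longrightarrow> e i \<in> C"
    and "\<And>i. i \<in> F \<Longrightarrow> (e i)\<^sup>2 - e i \<in> I"
    and "(\<Sum>i\<in>F. e i) \<in> I" and "j \<in> F"
  shows "e j \<in> I"
proof (rule annihilator_positive_plus_idempotents[of "F - {j}" e _ 1])
  have "e j * (of_nat 1 + (\<Sum>i\<in>F - {j}. e i)) = e j * (\<Sum>i\<in>F. e i) - ((e j)\<^sup>2 - e j)"
    using assms by (simp add: sum.remove[of F j] algebra_simps power2_eq_square)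
  also have "\<dots> \<in> I"
    using assms by (intro ideal_diff[OF ideal_mult]) auto
  finally show "e j * (of_nat 1 + (\<Sum>i\<in>F - {j}. e i)) \<in> I" .
qed (use assms in auto)

lemma idempotent_mult:
  assumes "a \<in> C" "b \<in> C" "a\<^sup>2 - a \<in> I" "b\<^sup>2 - b \<in> I"
  shows "(a * b)\<^sup>2 - a * b \<in> I"
proof -
  have "(a * b)\<^sup>2 - a * b = a\<^sup>2 * (b\<^sup>2 - b) + b * (a\<^sup>2 - a)"
    by (simp add: algebra_simps power2_eq_square)
  also have "\<dots> \<in> I"
    using assms by (intro ideal_add[OF ideal_mult ideal_mult]) (auto simp: power2_eq_square intro: mult_closed)
  finally show ?thesis .
qed

text \<open>The computation in one \<open>H\<close>-fibre, after the edges of \<open>G\<close> have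
  been removed. \<open>nbr\<close> is the generator for the vertex outside the fixed dominating set,
  \<open>pair\<close> the one for \<open>S = V - {a, b}\<close>, and \<open>dom\<close> the
  \<open>H\<close>-part of a domination generator of the product.\<close>

lemma fibre_sum_idempotent:
  fixes e :: "'b \<Rightarrow> 'b \<Rightarrow> 'r" and x :: "'b \<Rightarrow> 'r"
  assumes fin: "finite V" and d: "d \<in> V"
    and eC: "\<And>a b. a \<in> V \<Longrightarrow> b \<in> V \<Longrightarrow> a \<noteq> b \<Longrightarrow> e a b \<in> C"
    and xC: "\<And>a. a \<in> V \<Longrightarrow> x a \<in> C"
    and sym: "\<And>a b. e a b = e b a"
    and e_idem: "\<And>a b. a \<in> V \<Longrightarrow> b \<in> V \<Longrightarrow> a \<noteq> b \<Longrightarrow> (e a b)\<^sup>2 - e a b \<in> I"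
    and x_idem: "\<And>a. a \<in> V \<Longrightarrow> (x a)\<^sup>2 - x a \<in> I"
    and nbr: "(\<Prod>h\<in>V - {d}. 1 - e d h) \<in> I"
    and pair: "\<And>a b. a \<in> V \<Longrightarrow> b \<in> V \<Longrightarrow> a \<noteq> b \<Longrightarrow>
      (\<Sum>v\<in>V - {a, b}. e v a) * (\<Sum>v\<in>V - {a, b}. e v b) \<in> I"
    and dom: "\<And>h. h \<in> V \<Longrightarrow> (1 - x h) * (\<Prod>h'\<in>V - {h}. 1 - e h h' * x h') \<in> I"
  defines "s \<equiv> (\<Sum>h\<in>V. x h) - of_nat (card V - 1)"
  shows "s\<^sup>2 - s \<in> I"
proof -
  \<comment> \<open>Any two distinct edges have this shape: take from each an endpoint not on the
    other; \<open>p = q\<close> is the case of a common endpoint. The product in \<open>pair\<close>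
    expands into a sum of idempotents, so each summand vanishes.\<close>
  have two_edges: "e p a * e q b \<in> I"
    if "a \<in> V" "b \<in> V" "a \<noteq> b" "p \<in> V - {a, b}" "q \<in> V - {a, b}" for a b p q
  proof -
    let ?W = "V - {a, b}"
    let ?f = "\<lambda>(p, q). e p a * e q b"
    have "sum ?f (?W \<times> ?W) = (\<Sum>v\<in>?W. e v a) * (\<Sum>v\<in>?W. e v b)"
      by (simp add: sum_product sum.cartesian_product)
    then have "sum ?f (?W \<times> ?W) \<in> I"
      using pair that by simp
    then have "?f (p, q) \<in> I"
      by (rule summand_in_ideal[rotated 3])
        (use fin that eC e_idem in \<open>auto intro!: closed idempotent_mult\<close>)
    then show ?thesis by simp
  qed
  have sC: "s \<in> C"
    unfolding s_def by (auto intro!: closed xC)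
  have edge: "e d c * (s\<^sup>2 - s) \<in> I" if c: "c \<in> V" "c \<noteq> d" for c
  proof -
    define u where "u = e d c"
    have uC: "u \<in> C" and u_idem: "u\<^sup>2 - u \<in> I"
      using d c eC e_idem by (auto simp: u_def)
    have other_d: "u * e d h \<in> I" if "h \<in> V - {d, c}" for h
      using two_edges[of c h d d] d c that by (auto simp: u_def)
    \<comment> \<open>The edge between \<open>h\<close> and \<open>h'\<close> differs from the edge
      \<open>d c\<close>; the cases only select endpoints to which \<open>two_edges\<close>
      applies.\<close>
    have other: "u * e h h' \<in> I" if h: "h \<in> V - {d, c}" and h': "h' \<in> V - {h}" for h h'
    proof -
      consider "h' = d" | "h' = c" | "h' \<noteq> d" "h' \<noteq> c" by blast
      then show ?thesis
      proof cases
        case 1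
        then show ?thesis using other_d[OF h] by (simp add: sym)
      next
        case 2
        then show ?thesis
          using two_edges[of d h c c] d c h by (auto simp: u_def sym)
      next
        case 3
        then show ?thesis
          using two_edges[of c h d h'] d c h h' by (auto simp: u_def sym)
      qed
    qed
    \<comment> \<open>After multiplication by \<open>u\<close> the vertex \<open>h\<close> has no
      neighbours, so its domination generator reduces to \<open>1 - x h\<close>.\<close>
    have isolated: "u * (x h - 1) \<in> I" if h: "h \<in> V - {d, c}" for h
    proof -
      let ?P = "\<Prod>h'\<in>V - {h}. 1 - e h h' * x h'"
      have wC: "u * (1 - x h) \<in> C"
        using uC xC h by (auto intro: closed)
      have "u * (1 - x h) * (e h h' * x h') \<in> I" if h': "h' \<in> V - {h}" for h'
      proof -
        have "u * (1 - x h) * (e h h' * x h') = ((1 - x h) * x h') * (u * e h h')"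
          by (simp add: algebra_simps)
        also have "\<dots> \<in> I"
          using other[OF h h'] h h' xC by (intro ideal_mult[of "(1 - x h) * x h'"]) (auto intro!: closed)
        finally show ?thesis .
      qed
      then have "u * (1 - x h) * ?P - u * (1 - x h) \<in> I"
        using wC fin h eC xC by (intro mult_prod_one_minus) (auto intro!: closed)
      moreover have "u * ((1 - x h) * ?P) \<in> I"
        using ideal_mult[OF uC dom] h by simp
      ultimately have "(u * (1 - x h) * ?P - u * (1 - x h)) - u * ((1 - x h) * ?P) \<in> I"
        by (rule ideal_diff)
      then show ?thesis
        by (simp add: algebra_simps)
    qed
    have covered: "u * ((1 - x d) * (1 - x c)) \<in> I"
    proof -
      let ?P = "\<Prod>h\<in>V - {d, c}. 1 - e d h * x h"
      \<comment> \<open>\<open>1 - u * x c\<close> is the factor for \<open>c\<close> in the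
        domination generator at \<open>d\<close>, because \<open>e d c = u\<close>. The other
        factors, collected in \<open>?P\<close>, act as the identity on \<open>w\<close>.\<close>
      define w where "w = u * (1 - x d) * (1 - u * x c)"
      have wC: "w \<in> C"
        using uC xC d c by (auto simp: w_def intro!: closed)
      have "w * (e d h * x h) \<in> I" if h: "h \<in> V - {d, c}" for h
      proof -
        have "w * (e d h * x h) = ((1 - x d) * (1 - u * x c) * x h) * (u * e d h)"
          by (simp add: w_def algebra_simps)
        also have "\<dots> \<in> I"
          using other_d[OF h] d c h uC xC
          by (intro ideal_mult[of "(1 - x d) * (1 - u * x c) * x h"]) (auto intro!: closed)
        finally show ?thesis .
      qed
      then have "w * ?P - w \<in> I"
        using wC fin d eC xC by (intro mult_prod_one_minus) (auto intro!: closed)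
      moreover have "w * ?P \<in> I"
      proof -
        have "V - {d} - {c} = V - {d, c}" by auto
        then have "(\<Prod>h\<in>V - {d}. 1 - e d h * x h) = (1 - u * x c) * ?P"
          using fin c by (simp add: prod.remove[of "V - {d}" c] u_def)
        then have "w * ?P = u * ((1 - x d) * (\<Prod>h\<in>V - {d}. 1 - e d h * x h))"
          by (simp add: w_def mult.assoc)
        also have "\<dots> \<in> I"
          using ideal_mult[OF uC dom[OF d]] .
        finally show ?thesis .
      qed
      ultimately have "w * ?P - (w * ?P - w) \<in> I"
        by (rule ideal_diff[rotated])
      then have "w \<in> I" by simp
      \<comment> \<open>Turns the \<open>u\<^sup>2\<close> that arises in \<open>w\<close> into
        \<open>u\<close>.\<close>
      moreover have "((1 - x d) * x c) * (u\<^sup>2 - u) \<in> I"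
        using u_idem xC d c by (intro ideal_mult[of "(1 - x d) * x c"]) (auto intro!: closed)
      ultimately have "w + ((1 - x d) * x c) * (u\<^sup>2 - u) \<in> I"
        by (rule ideal_add)
      then show ?thesis
        by (simp add: w_def algebra_simps power2_eq_square)
    qed
    \<comment> \<open>\<open>s\<close> splits into the part \<open>r\<close> on the isolated
      vertices, killed by \<open>u\<close>, and the part \<open>y\<close> on the edge
      \<open>d c\<close>. Of the constant \<open>card V - 1\<close>, one unit goes to
      \<open>y\<close> and \<open>card V - 2\<close> to \<open>r\<close>.\<close>
    define r where "r = (\<Sum>h\<in>V - {d, c}. x h - 1)"
    define y where "y = x d + x c - 1"
    have rC: "r \<in> C" and yC: "y \<in> C"
      using xC d c by (auto simp: r_def y_def intro!: closed)
    have ur: "u * r \<in> I"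
      unfolding r_def sum_distrib_left by (intro ideal_sum isolated)
    have "card (V - {d, c}) = card V - 2"
      using fin d c by (simp add: card_Diff_subset)
    moreover have "2 \<le> card V"
      using card_mono[OF fin, of "{d, c}"] d c by simp
    ultimately have "card V - 1 = Suc (card (V - {d, c}))"
      by simp
    moreover have "V - {d} - {c} = V - {d, c}" by auto
    then have "(\<Sum>h\<in>V. x h) = x d + (x c + (\<Sum>h\<in>V - {d, c}. x h))"
      using fin d c by (simp add: sum.remove[of V d] sum.remove[of "V - {d}" c])
    ultimately have s_eq: "s = y + r"
      unfolding s_def y_def r_def by (simp add: sum_subtractf)
    \<comment> \<open>The first three terms are \<open>u * (y\<^sup>2 - y)\<close>, written through
      \<open>covered\<close> and the idempotence of \<open>x d\<close> and \<open>x c\<close>; the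
      last one collects all multiples of \<open>r\<close>.\<close>
    have "u * (s\<^sup>2 - s) = 2 * (u * ((1 - x d) * (1 - x c)))
        + u * ((x d)\<^sup>2 - x d) + u * ((x c)\<^sup>2 - x c) + (2 * y + r - 1) * (u * r)"
      unfolding s_eq y_def by (simp add: algebra_simps power2_eq_square)
    also have "\<dots> \<in> I"
      using covered x_idem d c ur uC rC yC
      by (intro ideal_add[OF ideal_add[OF ideal_add[OF ideal_mult ideal_mult] ideal_mult] ideal_mult])
        (auto intro!: closed)
    finally show ?thesis
      by (simp add: u_def)
  qed
  \<comment> \<open>The edges at \<open>d\<close> are mutually orthogonal, so the product in
    \<open>nbr\<close> is congruent to one minus their sum, which must therefore vanish.\<close>
  have "(\<Prod>h\<in>V - {d}. 1 - e d h) - (1 - (\<Sum>h\<in>V - {d}. e d h)) \<in> I"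
  proof (rule prod_one_minus_orthogonal)
    fix a b assume "a \<in> V - {d}" "b \<in> V - {d}" "a \<noteq> b"
    then show "e d a * e d b \<in> I"
      using d by (intro two_edges) auto
  qed (use fin d eC in auto)
  then have "(\<Prod>h\<in>V - {d}. 1 - e d h) - ((\<Prod>h\<in>V - {d}. 1 - e d h) - (1 - (\<Sum>h\<in>V - {d}. e d h))) \<in> I"
    by (rule ideal_diff[OF nbr])
  then have partition: "1 - (\<Sum>h\<in>V - {d}. e d h) \<in> I"
    by simp
  \<comment> \<open>The partition of unity by the \<open>e d h\<close> reduces the claim to the
    single edges treated in \<open>edge\<close>.\<close>
  have "s\<^sup>2 - s = (s\<^sup>2 - s) * (1 - (\<Sum>h\<in>V - {d}. e d h)) + (\<Sum>h\<in>V - {d}. e d h * (s\<^sup>2 - s))"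
    by (simp only: sum_distrib_right[symmetric]) (simp add: algebra_simps)
  also have "\<dots> \<in> I"
    using partition sC edge
    by (intro ideal_add[OF ideal_mult ideal_sum]) (auto simp: power2_eq_square intro!: closed)
  finally show ?thesis .
qed

end

section \<open>Polynomial rings over a subfield of the reals, and degrees\<close>

text \<open>Transfers algebraic closure properties to the type-class operations; the two notions of
  negative and of reciprocal agree by uniqueness of inverses.\<close>

lemma subfield_type_closed:
  fixes K :: "'a::field set"
  assumes "subfield K ring_of_type_algebra"
  shows "0 \<in> K" "1 \<in> K" "a \<in> K \<Longrightarrow> b \<in> K \<Longrightarrow> a - b \<in> K" "a \<in> K \<Longrightarrow> b \<in> K \<Longrightarrow> a + b \<in> K"
    "a \<in> K \<Longrightarrow> inverse a \<in> K"
proof -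
  let ?R = "ring_of_type_algebra :: 'a ring"
  interpret R: field ?R by (rule field_from_type_algebra)
  note sub = subringE[OF subfieldE(1)[OF assms]]
  have ops: "\<zero>\<^bsub>?R\<^esub> = 0" "\<one>\<^bsub>?R\<^esub> = 1" "x \<oplus>\<^bsub>?R\<^esub> y = x + y" "x \<otimes>\<^bsub>?R\<^esub> y = x * y"
    "x \<in> carrier ?R" for x y
    by (simp_all add: ring_of_type_algebra_def)
  show zero: "0 \<in> K" and "1 \<in> K"
    using sub(2,3) by (simp_all add: ops)
  show add: "a + b \<in> K" if "a \<in> K" "b \<in> K" for a b
    using sub(7)[OF that] by (simp add: ops)
  have minus: "\<ominus>\<^bsub>?R\<^esub> b = - b" for b
    using R.minus_equality[of "- b" b] by (simp add: ops)
  show "a - b \<in> K" if "a \<in> K" "b \<in> K"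
    using add[OF that(1) sub(5)[OF that(2)]] by (simp add: minus)
  show "inverse a \<in> K" if "a \<in> K"
  proof (cases "a = 0")
    case False
    then have "inv\<^bsub>?R\<^esub> a \<in> K" "a * inv\<^bsub>?R\<^esub> a = 1"
      using R.subfield_m_inv(1,2)[OF assms, of a] that by (auto simp: ops)
    then show ?thesis
      using inverse_unique by metis
  qed (use zero in simp)
qed

lemma poly_ring_simps:
  "\<zero>\<^bsub>poly_ring K A\<^esub> = 0" "\<one>\<^bsub>poly_ring K A\<^esub> = 1"
  "p \<oplus>\<^bsub>poly_ring K A\<^esub> q = p + q" "p \<otimes>\<^bsub>poly_ring K A\<^esub> q = p * q"
  "p \<in> carrier (poly_ring K A) \<longleftrightarrow> (\<forall>m. Poly_Mapping.lookup p m \<in> K) \<and>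
     (\<forall>m \<in> Poly_Mapping.keys p. Poly_Mapping.keys m \<subseteq> A)"
  by (simp_all add: poly_ring_def ring_of_type_algebra_def)

context
  fixes K :: "real set" and A :: "'v set"
  assumes K: "subfield K ring_of_type_algebra"
begin

lemma const_in_poly_ring: "c \<in> K \<Longrightarrow> Poly_Mapping.single 0 c \<in> carrier (poly_ring K A)"
  using subfield_type_closed[OF K]
  by (auto simp: poly_ring_simps lookup_single when_def)

lemma zero_in_poly_ring: "0 \<in> carrier (poly_ring K A)"
  using const_in_poly_ring[of 0] subfield_type_closed[OF K] by simp

lemma one_in_poly_ring: "1 \<in> carrier (poly_ring K A)"
  using const_in_poly_ring[of 1] subfield_type_closed[OF K] by simp

lemma Var_in_poly_ring: "v \<in> A \<Longrightarrow> Var v \<in> carrier (poly_ring K A)"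
  using subfield_type_closed[OF K]
  by (auto simp: poly_ring_simps Var_def lookup_single when_def)

lemma add_in_poly_ring:
  "p \<in> carrier (poly_ring K A) \<Longrightarrow> q \<in> carrier (poly_ring K A) \<Longrightarrow> p + q \<in> carrier (poly_ring K A)"
  using subfield_type_closed(4)[OF K] Poly_Mapping.keys_add[of p q]
  unfolding poly_ring_simps lookup_add by blast

lemma diff_in_poly_ring:
  "p \<in> carrier (poly_ring K A) \<Longrightarrow> q \<in> carrier (poly_ring K A) \<Longrightarrow> p - q \<in> carrier (poly_ring K A)"
  using subfield_type_closed(3)[OF K] keys_diff[of p q]
  unfolding poly_ring_simps lookup_minus by blast

lemma sum_in_poly_ring:
  "(\<And>i. i \<in> F \<Longrightarrow> f i \<in> carrier (poly_ring K A)) \<Longrightarrow> sum f F \<in> carrier (poly_ring K A)"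
  by (induction F rule: infinite_finite_induct) (auto intro: zero_in_poly_ring add_in_poly_ring)

lemma of_nat_in_poly_ring: "of_nat n \<in> carrier (poly_ring K A)"
  by (induction n) (auto intro: zero_in_poly_ring one_in_poly_ring add_in_poly_ring)

text \<open>A subfield of the reals contains every \<open>inverse (real n)\<close>, and the
  corresponding constant polynomial inverts \<open>n\<close>. Closure under multiplication comes
  from the ring structure contained in \<open>ideal\<close>.\<close>

lemma rational_ideal_poly_ring:
  assumes "ideal I (poly_ring K A)"
  shows "rational_ideal (carrier (poly_ring K A)) I"
proof -
  interpret ideal I "poly_ring K A" by (rule assms)
  show ?thesis
  proof
    fix n :: nat assume "0 < n"
    have "real n \<in> K"
      by (induction n) (use subfield_type_closed[OF K] in \<open>auto simp: add.commute\<close>)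
    then have "inverse (real n) \<in> K"
      using subfield_type_closed[OF K] by blast
    moreover have "Poly_Mapping.single 0 (inverse (real n)) * of_nat n
        = (1 :: ('v \<Rightarrow>\<^sub>0 nat) \<Rightarrow>\<^sub>0 real)"
      using \<open>0 < n\<close> by (simp add: mult_single flip: single_of_nat)
    ultimately show "\<exists>c\<in>carrier (poly_ring K A). c * of_nat n = 1"
      using const_in_poly_ring by blast
  next
    show "1 \<in> carrier (poly_ring K A)"
      by (rule one_in_poly_ring)
    show "a - b \<in> carrier (poly_ring K A)"
      if "a \<in> carrier (poly_ring K A)" "b \<in> carrier (poly_ring K A)" for a b
      using that by (rule diff_in_poly_ring)
    show "a * b \<in> carrier (poly_ring K A)"
      if "a \<in> carrier (poly_ring K A)" "b \<in> carrier (poly_ring K A)" for a b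
      using m_closed[OF that] by (simp only: poly_ring_simps(4))
    show "I \<subseteq> carrier (poly_ring K A)"
      by (rule a_subset)
    show "0 \<in> I"
      using additive_subgroup.zero_closed[OF is_additive_subgroup] by (simp only: poly_ring_simps(1))
    show "a + b \<in> I" if "a \<in> I" "b \<in> I" for a b
      using additive_subgroup.a_closed[OF is_additive_subgroup that] by (simp only: poly_ring_simps(3))
    show "c * a \<in> I" if "c \<in> carrier (poly_ring K A)" "a \<in> I" for c a
      using I_l_closed[OF that(2,1)] by (simp only: poly_ring_simps(4))
  qed
qed

end

lemma total_degree_le:
  assumes "\<And>m. m \<in> Poly_Mapping.keys p \<Longrightarrow> monomial_degree m \<le> l"
  shows "total_degree p \<le> l"
  using assms by (auto simp: total_degree_def)

text \<open>Cancellation can only remove monomials, so each one left is \<open>0\<close> (the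
  constant monomial) or a single variable.\<close>

lemma total_degree_sum_Var_minus_const:
  fixes v :: "'i \<Rightarrow> 'v"
  shows "total_degree ((\<Sum>i\<in>F. Var (v i)) - of_nat k) \<le> 1"
proof (rule total_degree_le)
  fix m
  assume "m \<in> Poly_Mapping.keys ((\<Sum>i\<in>F. Var (v i)) - of_nat k)"
  then have "m \<in> Poly_Mapping.keys (\<Sum>i\<in>F. Var (v i)) \<or> m \<in> Poly_Mapping.keys (of_nat k :: 'v mpoly)"
    using keys_diff[of "\<Sum>i\<in>F. Var (v i)" "of_nat k"] by blast
  moreover have "m = 0" if "m \<in> Poly_Mapping.keys (of_nat k :: 'v mpoly)"
    using that by (auto simp: in_keys_iff lookup_of_nat when_def split: if_splits)
  moreover have "\<exists>i\<in>F. m = Poly_Mapping.single (v i) 1" if "m \<in> Poly_Mapping.keys (\<Sum>i\<in>F. Var (v i))"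
  proof -
    have "(\<Sum>i\<in>F. Poly_Mapping.lookup (Var (v i)) m) \<noteq> 0"
      using that by (simp add: in_keys_iff lookup_sum)
    then obtain i where "i \<in> F" "Poly_Mapping.lookup (Var (v i)) m \<noteq> 0"
      by (meson sum.neutral)
    then show ?thesis
      by (auto simp: Var_def lookup_single when_def split: if_splits)
  qed
  ultimately show "monomial_degree m \<le> 1"
    by (auto simp: monomial_degree_def)
qed

section \<open>The sum-of-squares certificate\<close>

lemma vizing_certificate:
  fixes VG DG :: "'a set" and VH DH :: "'b set"
  assumes K: "subfield K ring_of_type_algebra"
    and VG: "finite VG" and VH: "finite VH"
    and DH: "DH \<subseteq> VH" "card DH = card VH - 1" and VH3: "3 \<le> card VH"
  shows "sos_certificate (vizing_ring K VG VH) (I_sos K VG DG (card VG) VH DH (card VH - 1)) 1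
    ((\<Sum>g \<in> VG. \<Sum>h \<in> VH. xGH g h) - of_nat (card VG * (card VH - 1)))
    VG (\<lambda>g. (\<Sum>h \<in> VH. xGH g h) - of_nat (card VH - 1))"
proof -
  define A where "A = vizing_vars VG VH"
  define C where "C = carrier (poly_ring K A)"
  have x_closed: "xGH g h \<in> C" if "g \<in> VG" "h \<in> VH" for g h
    unfolding C_def xGH_def
    by (rule Var_in_poly_ring[OF K]) (use that in \<open>auto simp: A_def vizing_vars_def\<close>)
  have eG_closed: "eG g g' \<in> C" if "g \<in> VG" "g' \<in> VG" "g \<noteq> g'" for g g'
    unfolding C_def eG_def
    by (rule Var_in_poly_ring[OF K]) (use that in \<open>auto simp: A_def vizing_vars_def\<close>)
  have eH_closed: "eH h h' \<in> C" if "h \<in> VH" "h' \<in> VH" "h \<noteq> h'" for h h'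
    unfolding C_def eH_def
    by (rule Var_in_poly_ring[OF K]) (use that in \<open>auto simp: A_def vizing_vars_def\<close>)
  let ?s = "\<lambda>g. (\<Sum>h\<in>VH. xGH g h) - of_nat (card VH - 1) :: ('a, 'b) vizing_var mpoly"
  let ?f = "(\<Sum>g\<in>VG. \<Sum>h\<in>VH. xGH g h) - of_nat (card VG * (card VH - 1)) :: ('a, 'b) vizing_var mpoly"
  \<comment> \<open>Exactly one vertex \<open>d\<close> lies outside \<open>DH\<close>; its
    generator will supply \<open>nbr\<close>.\<close>
  have "card (VH - DH) = 1"
    using DH VH VH3 card_Diff_subset[of DH VH] finite_subset[of DH VH] by simp
  then obtain d where d: "VH - DH = {d}"
    by (rule card_1_singletonE)
  then have DH_eq: "DH = VH - {d}" and dV: "d \<in> VH"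
    using DH by auto
  \<comment> \<open>The generated ideal is the intersection of all ideals containing the generators,
    so it suffices to argue in an arbitrary such \<open>I\<close>.\<close>
  have "?f - (\<Sum>g\<in>VG. (?s g)\<^sup>2) \<in> I"
    if I: "ideal I (poly_ring K A)"
      and gens: "factor_gens eG VG DG (card VG) \<union> factor_gens eH VH DH (card VH - 1) \<union> product_gens VG VH \<subseteq> I"
    for I
  proof -
    interpret rational_ideal C I
      unfolding C_def by (rule rational_ideal_poly_ring[OF K I])
    have eG_idem: "(eG g g')\<^sup>2 - eG g g' \<in> I" if "g \<in> VG" "g' \<in> VG" "g \<noteq> g'" for g g'
      by (rule subsetD[OF gens]) (use that in \<open>unfold factor_gens_def, blast\<close>)
    have eH_idem: "(eH h h')\<^sup>2 - eH h h' \<in> I" if "h \<in> VH" "h' \<in> VH" "h \<noteq> h'" for h h'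
      by (rule subsetD[OF gens]) (use that in \<open>unfold factor_gens_def, blast\<close>)
    have x_idem: "(xGH g h)\<^sup>2 - xGH g h \<in> I" if "g \<in> VG" "h \<in> VH" for g h
      by (rule subsetD[OF gens]) (use that in \<open>unfold product_gens_def, blast\<close>)
    have nbr: "(\<Prod>h\<in>VH - {d}. 1 - eH d h) \<in> I"
      by (rule subsetD[OF gens]) (use d in \<open>unfold factor_gens_def DH_eq, blast\<close>)
    have eG_zero: "eG g g' \<in> I" if g: "g \<in> VG" "g' \<in> VG" "g \<noteq> g'" for g g'
    proof -
      \<comment> \<open>\<open>S = VG - {g}\<close> has the required size, as the domination number
        of \<open>G\<close> is \<open>card VG\<close>. The product then has one factor: a vanishing
        sum of idempotents.\<close>
      have "(\<Prod>v'\<in>VG - (VG - {g}). \<Sum>v\<in>VG - {g}. eG v v') \<in> factor_gens eG VG DG (card VG)"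
        unfolding factor_gens_def using VG g by (auto intro!: exI[of _ "VG - {g}"] simp: card_Diff_singleton)
      moreover have "VG - (VG - {g}) = {g}"
        using g by auto
      ultimately have "(\<Sum>v\<in>VG - {g}. eG v g) \<in> I"
        using gens by auto
      then have "eG g' g \<in> I"
        by (rule summand_in_ideal[rotated 3])
          (use VG g eG_closed eG_idem in auto)
      then show ?thesis
        by (simp add: eG_def insert_commute)
    qed
    have idem: "(?s g)\<^sup>2 - ?s g \<in> I" if g: "g \<in> VG" for g
    proof (rule fibre_sum_idempotent[where e = eH and d = d])
      show "(\<Sum>v\<in>VH - {a, b}. eH v a) * (\<Sum>v\<in>VH - {a, b}. eH v b) \<in> I"
        if ab: "a \<in> VH" "b \<in> VH" "a \<noteq> b" for a b
      proof -
        \<comment> \<open>Here the size of \<open>S\<close> is one below \<open>card VH - 1\<close>,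
          so its complement has two points and the generator is a product of two sums.\<close>
        have "card (VH - {a, b}) = card VH - 1 - 1"
          using ab VH by (simp add: card_Diff_subset)
        then have "(\<Prod>v'\<in>VH - (VH - {a, b}). \<Sum>v\<in>VH - {a, b}. eH v v')
            \<in> factor_gens eH VH DH (card VH - 1)"
          unfolding factor_gens_def by blast
        moreover have "VH - (VH - {a, b}) = {a, b}"
          using ab by auto
        ultimately show ?thesis
          using gens ab by auto
      qed
      show "(1 - xGH g h) * (\<Prod>h'\<in>VH - {h}. 1 - eH h h' * xGH g h') \<in> I" if h: "h \<in> VH" for h
      proof -
        \<comment> \<open>All \<open>eG\<close> vanish, so the \<open>G\<close>-part
          \<open>?PG\<close> of the domination generator acts as the identity and only the
          \<open>H\<close>-part \<open>?w\<close> remains.\<close>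
        let ?PG = "\<Prod>g'\<in>VG - {g}. 1 - eG g g' * xGH g' h :: ('a, 'b) vizing_var mpoly"
        let ?w = "(1 - xGH g h) * (\<Prod>h'\<in>VH - {h}. 1 - eH h h' * xGH g h') :: ('a, 'b) vizing_var mpoly"
        have wC: "?w \<in> C"
          using g h x_closed eH_closed by (auto intro!: closed)
        have "?w * (eG g g' * xGH g' h) \<in> I" if "g' \<in> VG - {g}" for g'
        proof -
          have "(?w * xGH g' h) * eG g g' \<in> I"
            using that g h by (intro ideal_mult mult_closed wC x_closed eG_zero) auto
          then show ?thesis
            by (simp only: mult_ac)
        qed
        then have "?w * ?PG - ?w \<in> I"
          using VG wC g h x_closed eG_closed by (intro mult_prod_one_minus) (auto intro!: closed)
        moreover have "(1 - xGH g h) * ?PG * (\<Prod>h'\<in>VH - {h}. 1 - eH h h' * xGH g h') \<in> product_gens VG VH"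
          unfolding product_gens_def using g h by blast
        then have "?w * ?PG \<in> I"
          using gens by (auto simp: mult_ac)
        ultimately have "?w * ?PG - (?w * ?PG - ?w) \<in> I"
          by (rule ideal_diff[rotated])
        then show ?thesis by simp
      qed
      show "eH a b = eH b a" for a b
        by (simp add: eH_def insert_commute)
    qed (use VH dV g x_closed eH_closed eH_idem x_idem nbr in auto)
    \<comment> \<open>The constant \<open>card VH - 1\<close> is subtracted once for each of the
      \<open>card VG\<close> fibres.\<close>
    have "?f = (\<Sum>g\<in>VG. ?s g)"
      by (simp add: sum_subtractf)
    then have "?f - (\<Sum>g\<in>VG. (?s g)\<^sup>2) = - (\<Sum>g\<in>VG. (?s g)\<^sup>2 - ?s g)"
      by (simp add: sum_subtractf)
    also have "\<dots> \<in> I"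
      by (intro ideal_uminus ideal_sum idem)
    finally show ?thesis .
  qed
  moreover have "?s g \<in> C" if "g \<in> VG" for g
    using that x_closed unfolding C_def
    by (intro diff_in_poly_ring[OF K] sum_in_poly_ring[OF K] of_nat_in_poly_ring[OF K])
  moreover have "?f \<in> C"
    using x_closed unfolding C_def
    by (intro diff_in_poly_ring[OF K] sum_in_poly_ring[OF K] of_nat_in_poly_ring[OF K])
  moreover have "total_degree (?s g) \<le> 1" for g
    unfolding xGH_def by (rule total_degree_sum_Var_minus_const)
  ultimately show ?thesis
    using VG unfolding sos_certificate_def I_sos_def genideal_def vizing_ring_def C_def A_def
    by blast
qed

section \<open>Domination numbers of graphs and Vizing's inequality\<close>

lemma domination_number_le:
  assumes "finite (pverts G)" and "dominating G D"
  shows "domination_number G \<le> card D"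
proof -
  have "{card D | D. dominating G D} \<subseteq> card ` Pow (pverts G)"
    by (auto simp: dominating_def)
  then have "finite {card D | D. dominating G D}"
    using assms(1) by (meson finite_Pow_iff finite_imageI finite_subset)
  then show ?thesis
    unfolding domination_number_def using assms(2) by (auto intro!: Min_le)
qed

lemma obtain_minimum_dominating:
  assumes "finite (pverts G)"
  obtains D where "dominating G D" "card D = domination_number G"
proof -
  have "{card D | D. dominating G D} \<subseteq> card ` Pow (pverts G)"
    by (auto simp: dominating_def)
  then have "finite {card D | D. dominating G D}"
    using assms by (meson finite_Pow_iff finite_imageI finite_subset)
  moreover have "dominating G (pverts G)"
    by (simp add: dominating_def)
  ultimately have "domination_number G \<in> {card D | D. dominating G D}"
    unfolding domination_number_def by (intro Min_in) auto
  then show thesis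
    using that by auto
qed

text \<open>If there is an arc from \<open>v\<close> to \<open>w\<close>, then \<open>w\<close>
  differs from \<open>v\<close> and dominates it, so \<open>v\<close> can be left out of the full
  vertex set.\<close>

lemma edgeless_if_domination_number_eq_card:
  assumes "pair_digraph G" and "domination_number G = card (pverts G)"
  shows "parcs G = {}"
proof (rule ccontr)
  interpret pair_digraph G by (rule assms)
  assume "parcs G \<noteq> {}"
  then obtain v w where vw: "(v, w) \<in> parcs G" by auto
  then have "dominating G (pverts G - {v})"
    using no_loops'[OF vw] in_arcsD2[OF vw] by (auto simp: dominating_def)
  then have "domination_number G \<le> card (pverts G - {v})"
    using pair_finite_verts by (rule domination_number_le[rotated])
  also have "\<dots> < card (pverts G)"
    using pair_finite_verts in_arcsD1[OF vw] by (rule card_Diff1_less)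
  finally show False
    using assms by simp
qed

text \<open>The product is a disjoint union of copies of \<open>H\<close>, one for each vertex of
  \<open>G\<close>. A minimum dominating set is the disjoint union of its fibres, and the bounds for
  the fibres add up.\<close>

lemma vizing_edgeless:
  assumes G: "finite (pverts G)" "parcs G = {}" and H: "finite (pverts H)"
  shows "card (pverts G) * domination_number H \<le> domination_number (cartesian_graph_product G H)"
proof -
  let ?P = "cartesian_graph_product G H"
  have P: "pverts ?P = pverts G \<times> pverts H"
    by (simp add: cartesian_graph_product_def)
  then obtain D where D: "dominating ?P D" "card D = domination_number ?P"
    using G H obtain_minimum_dominating[of ?P] by auto
  have D_sub: "D \<subseteq> pverts G \<times> pverts H"
    using D P by (simp add: dominating_def)
  have fibre: "domination_number H \<le> card (D `` {g})" if g: "g \<in> pverts G" for g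
  proof (rule domination_number_le[OF H])
    show "dominating H (D `` {g})"
      unfolding dominating_def
    proof (intro conjI ballI)
      show "D `` {g} \<subseteq> pverts H" using D_sub by auto
      fix h assume "h \<in> pverts H - D `` {g}"
      then have "(g, h) \<in> pverts ?P - D" using g P by auto
      then obtain u where "u \<in> D" "((g, h), u) \<in> parcs ?P"
        using D(1) unfolding dominating_def by blast
      then show "\<exists>u\<in>D `` {g}. (h, u) \<in> parcs H"
        using G by (auto simp: cartesian_graph_product_def)
    qed
  qed
  have "D = (SIGMA g:pverts G. D `` {g})"
    using D_sub by auto
  moreover have "finite (D `` {g})" for g
    using D_sub G H by (meson finite_Image finite_SigmaI finite_subset)
  ultimately have "card D = (\<Sum>g\<in>pverts G. card (D `` {g}))"
    using G card_SigmaI[of "pverts G" "\<lambda>g. D `` {g}"] by simp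
  also have "\<dots> \<ge> (\<Sum>g\<in>pverts G. domination_number H)"
    by (intro sum_mono fibre)
  finally show ?thesis
    using D by simp
qed

theorem theorem5p1:
  fixes nG kG nH kH :: nat
  assumes "kG = nG" and "nG \<ge> 2" and "kH = nH - 1" and "nH - 1 \<ge> 2"
  shows
    "(\<forall>(K :: real set) (VG :: 'a set) DG (VH :: 'b set) DH.
        subfield K ring_of_type_algebra \<and>
        finite VG \<and> card VG = nG \<and> DG \<subseteq> VG \<and> card DG = kG \<and>
        finite VH \<and> card VH = nH \<and> DH \<subseteq> VH \<and> card DH = kH \<longrightarrow>
        sos_certificate (vizing_ring K VG VH) (I_sos K VG DG kG VH DH kH) 1
          ((\<Sum>g \<in> VG. \<Sum>h \<in> VH. xGH g h) - of_nat (kG * kH))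
          VG (\<lambda>g. (\<Sum>h \<in> VH. xGH g h) - of_nat kH)) \<and>
     (\<forall>(G :: 'c pair_pre_digraph) (H :: 'd pair_pre_digraph).
        pair_graph G \<and> card (pverts G) = nG \<and> domination_number G = kG \<and>
        pair_graph H \<and> card (pverts H) = nH \<and> domination_number H = kH \<longrightarrow>
        domination_number G * domination_number H
          \<le> domination_number (cartesian_graph_product G H))"
proof (intro conjI allI impI, goal_cases)
  case (1 K VG DG VH DH)
  then show ?case
    using assms vizing_certificate[of K VG VH DH DG] by auto
next
  \<comment> \<open>The inequality is obtained combinatorially: equality of \<open>kG\<close> and
    \<open>nG\<close> forces \<open>G\<close> to be edgeless.\<close>
  case (2 G H)
  then have fin: "pair_digraph G" "finite (pverts G)" "finite (pverts H)"
    by (auto simp: pair_graph_def pair_digraph_def pair_fin_digraph_def pair_fin_digraph_axioms_def)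
  have dom: "domination_number G = card (pverts G)"
    using 2 assms by simp
  then have "parcs G = {}"
    using fin edgeless_if_domination_number_eq_card by blast
  then show ?case
    using fin vizing_edgeless dom by metis
qed

end
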